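(* Let $1\le k\le n$ and let $\mathbb{S}_{(a_1,\ldots,a_k)}\times\{a_{k+1}\}\times\cdots\times\{a_n\}\subset\mathbb{H}^n$ be a balloon with $a_\ell\notin\mathbb{R}$ for every $1\le\ell\le k$. A slice regular polynomial $P\in\mathbb{H}[q_1,\ldots,q_n]$ vanishes on this balloon if and only if $P$ can be written as $$\sum_{\ell=1}^{k-1}Q_\ell*P_\ell(q_\ell,\ldots,q_n)+S_{a_k}*P_k(q_k,\ldots,q_n)+\sum_{\ell=k+1}^n(q_\ell-a_\ell)*P_\ell(q_1,\ldots,q_n),$$ where each $P_\ell$ is a slice regular polynomial in the indicated variables.
   Context: $\mathbb{H}$ is the skew field of quaternions. A slice regular polynomial in $n$ variables is a function $P:\mathbb{H}^n\to\mathbb{H}$ of the form $P(q_1,\ldots,q_n)=\sum_{\ell} q_1^{\ell_1}\cdots q_n^{\ell_n}a_{\ell_1,\ldots,\ell_n}$ (finite sum over multi-indices, variables in this fixed order, coefficients in $\mathbb{H}$ on the right). $\mathbb{H}[q_1,\ldots,q_n]$ is the set of these; it is a (non-commutative) ring under $+$ and the $*$-product, the biadditive extension of $(q_1^{\ell_1}\cdots q_n^{\ell_n}a)*(q_1^{m_1}\cdots q_n^{m_n}b)=q_1^{\ell_1+m_1}\cdots q_n^{\ell_n+m_n}ab$. Polynomials in fewer of the variables are regarded as elements of $\mathbb{H}[q_1,\ldots,q_n]$. Let $\mathbb{S}_{(a_1,\ldots,a_k)}=\{(g^{-1}a_1g,\ldots,g^{-1}a_kg): g\in\mathbb{H}\setminus\{0\}\}$;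 it is called an arranged spherical set if $a_la_m=a_ma_l$ for all $1\le l,m\le k$. A balloon is a set $\mathbb{S}_{(a_1,\ldots,a_k)}\times\{a_{k+1}\}\times\cdots\times\{a_n\}$ where $\mathbb{S}_{(a_1,\ldots,a_k)}$ is an arranged spherical set and $a_la_m=a_ma_l$ for all $l,m>k$. $S_{a_k}(q_k)=q_k^2-2\,\mathrm{Re}(a_k)q_k+|a_k|^2$. Since $a_1,\ldots,a_k$ commute and are non-real, there is an imaginary unit $J$ (i.e. $J^2=-1$) with $a_\ell=x_\ell+y_\ell J$, $x_\ell,y_\ell\in\mathbb{R}$, $y_\ell\neq0$, for $1\le\ell\le k$; the sign of $y_\ell y_{\ell+1}$ does not depend on the choice of $J$. For $1\le\ell\le k-1$, $Q_\ell$ is the polynomial with real coefficients $Q_\ell(q_\ell,q_{\ell+1})=q_\ell+q_{\ell+1}\gamma_\ell+\delta_\ell$, where, if $y_\ell y_{\ell+1}>0$, $\gamma_\ell=-\frac{|\mathrm{Im}(a_\ell)|}{|\mathrm{Im}(a_{\ell+1})|}$ and $\delta_\ell=-\mathrm{Re}(a_\ell)+\frac{\mathrm{Re}(a_{\ell+1})|\mathrm{Im}(a_\ell)|}{|\mathrm{Im}(a_{\ell+1})|}$, while if $y_\ell y_{\ell+1}<0$, $\gamma_\ell=\frac{|\mathrm{Im}(a_\ell)|}{|\mathrm{Im}(a_{\ell+1})|}$ and $\delta_\ell=-\mathrm{Re}(a_\ell)-\frac{\mathrm{Re}(a_{\ell+1})|\mathrm{Im}(a_\ell)|}{|\mathrm{Im}(a_{\ell+1})|}$.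 Here $\mathrm{Im}(a)=a-\mathrm{Re}(a)$. *)

theory Defs
  imports "HOL-Analysis.Analysis" "HOL-Library.Poly_Mapping"
begin

codatatype quat = Quat (qRe: real) (qI: real) (qJ: real) (qK: real)

lemma quat_eq_iff: "x = y \<longleftrightarrow> qRe x = qRe y \<and> qI x = qI y \<and> qJ x = qJ y \<and> qK x = qK y"
  by (auto intro: quat.expand)

lemma quat_eqI: "qRe x = qRe y \<Longrightarrow> qI x = qI y \<Longrightarrow> qJ x = qJ y \<Longrightarrow> qK x = qK y \<Longrightarrow> x = y"
  by (simp add: quat_eq_iff)

instantiation quat :: ab_group_add
begin

primcorec zero_quat where
  "qRe 0 = 0" | "qI 0 = 0" | "qJ 0 = 0" | "qK 0 = 0"

primcorec plus_quat where
  "qRe (x + y) = qRe x + qRe y"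
| "qI (x + y) = qI x + qI y"
| "qJ (x + y) = qJ x + qJ y"
| "qK (x + y) = qK x + qK y"

primcorec uminus_quat where
  "qRe (- x) = - qRe x" | "qI (- x) = - qI x" | "qJ (- x) = - qJ x" | "qK (- x) = - qK x"

primcorec minus_quat where
  "qRe (x - y) = qRe x - qRe y"
| "qI (x - y) = qI x - qI y"
| "qJ (x - y) = qJ x - qJ y"
| "qK (x - y) = qK x - qK y"

instance
  by standard (simp_all add: quat_eq_iff)

end

instantiation quat :: ring_1
begin

primcorec one_quat where
  "qRe 1 = 1" | "qI 1 = 0" | "qJ 1 = 0" | "qK 1 = 0"

primcorec times_quat where
  "qRe (x * y) = qRe x * qRe y - qI x * qI y - qJ x * qJ y - qK x * qK y"
| "qI (x * y) = qRe x * qI y + qI x * qRe y + qJ x * qK y - qK x * qJ y"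
| "qJ (x * y) = qRe x * qJ y - qI x * qK y + qJ x * qRe y + qK x * qI y"
| "qK (x * y) = qRe x * qK y + qI x * qJ y - qJ x * qI y + qK x * qRe y"

instance
  by standard (simp_all add: quat_eq_iff algebra_simps)

end

instantiation quat :: real_algebra_1
begin

primcorec scaleR_quat where
  "qRe (scaleR r x) = r * qRe x"
| "qI (scaleR r x) = r * qI x"
| "qJ (scaleR r x) = r * qJ x"
| "qK (scaleR r x) = r * qK x"

instance
  by standard (simp_all add: quat_eq_iff algebra_simps)

end

instantiation quat :: real_inner
begin

definition inner_quat :: "quat \<Rightarrow> quat \<Rightarrow> real" where
  "inner_quat x y = qRe x * qRe y + qI x * qI y + qJ x * qJ y + qK x * qK y"

definition norm_quat :: "quat \<Rightarrow> real" where
  "norm_quat x = sqrt ((qRe x)\<^sup>2 + (qI x)\<^sup>2 + (qJ x)\<^sup>2 + (qK x)\<^sup>2)"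

definition sgn_quat :: "quat \<Rightarrow> quat" where
  "sgn_quat x = x /\<^sub>R norm x"

definition dist_quat :: "quat \<Rightarrow> quat \<Rightarrow> real" where
  "dist_quat x y = norm (x - y)"

definition uniformity_quat :: "(quat \<times> quat) filter" where
  "uniformity_quat = (INF e\<in>{0 <..}. principal {(x, y). dist x y < e})"

definition open_quat :: "quat set \<Rightarrow> bool" where
  "open_quat U \<longleftrightarrow> (\<forall>x\<in>U. eventually (\<lambda>(x', y). x' = x \<longrightarrow> y \<in> U) uniformity)"

instance
proof
  fix x :: quat
  have nonneg: "0 \<le> (qRe x)\<^sup>2 + (qI x)\<^sup>2 + (qJ x)\<^sup>2 + (qK x)\<^sup>2" by simp
  then show "0 \<le> inner x x"
    by (simp add: inner_quat_def power2_eq_square)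
  have "(qRe x)\<^sup>2 + (qI x)\<^sup>2 + (qJ x)\<^sup>2 + (qK x)\<^sup>2 = 0
        \<longleftrightarrow> qRe x = 0 \<and> qI x = 0 \<and> qJ x = 0 \<and> qK x = 0"
    by (simp add: add_nonneg_eq_0_iff)
  then show "inner x x = 0 \<longleftrightarrow> x = 0"
    by (simp add: inner_quat_def quat_eq_iff power2_eq_square)
qed (simp_all add: inner_quat_def norm_quat_def sgn_quat_def dist_quat_def
      uniformity_quat_def open_quat_def algebra_simps power2_eq_square)

end

lemma quat_norm_mult: "norm (x * y) = norm x * norm y" for x y :: quat
proof -
  have "(norm (x * y))\<^sup>2 = (norm x)\<^sup>2 * (norm y)\<^sup>2"
    by (simp add: norm_quat_def) algebra
  then show ?thesis
    by (metis norm_ge_zero power2_eq_imp_eq power_mult_distrib mult_nonneg_nonneg)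
qed

instance quat :: real_normed_algebra_1
proof
  show "norm (x * y) \<le> norm x * norm y" for x y :: quat
    by (simp add: quat_norm_mult)
  show "norm (1::quat) = 1"
    by (simp add: norm_quat_def)
qed

instantiation quat :: real_normed_div_algebra
begin

primcorec inverse_quat where
  "qRe (inverse x) = qRe x / (norm x)\<^sup>2"
| "qI (inverse x) = - qI x / (norm x)\<^sup>2"
| "qJ (inverse x) = - qJ x / (norm x)\<^sup>2"
| "qK (inverse x) = - qK x / (norm x)\<^sup>2"

definition divide_quat :: "quat \<Rightarrow> quat \<Rightarrow> quat" where
  "divide_quat x y = x * inverse y"

instance
proof
  fix x y :: quat
  show "norm (x * y) = norm x * norm y"
    by (rule quat_norm_mult)
  show "x div y = x * inverse y"
    by (simp add: divide_quat_def)
  show "inverse (0::quat) = 0"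
    by (simp add: quat_eq_iff)
  assume "x \<noteq> 0"
  then have n: "(norm x)\<^sup>2 \<noteq> 0" by simp
  have s: "(norm x)\<^sup>2 = qRe x * qRe x + qI x * qI x + qJ x * qJ x + qK x * qK x"
    by (simp add: norm_quat_def power2_eq_square)
  from n show "inverse x * x = 1"
    unfolding quat_eq_iff using s by (simp add: divide_simps)
  from n show "x * inverse x = 1"
    unfolding quat_eq_iff using s by (simp add: divide_simps)
qed

end

definition qIm :: "quat \<Rightarrow> quat" where
  "qIm a = a - of_real (qRe a)"

text \<open>
  A slice regular polynomial is represented by its (finitely supported) family of coefficients,
  indexed by multi-indices with support in the set of variable indices. Multiplication of
  \<^typ>\<open>(nat \<Rightarrow>\<^sub>0 nat) \<Rightarrow>\<^sub>0 quat\<close> is convolution, that is, the biadditive extension of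
  \<open>(q\<^sup>\<ell> a) * (q\<^sup>m b) = q\<^bsup>\<ell>+m\<^esup> (a b)\<close> (the \<open>*\<close>-product), not the pointwise product of functions.
  By lemma \<open>slice_eval_inject\<close> below the coefficients are determined by the function
  \<open>slice_eval n p\<close> on \<open>\<bbbH>\<^sup>n\<close>, so elements of \<open>slice_polys {1..n}\<close> correspond bijectively to slice
  regular polynomial functions.
\<close>

type_synonym slice_poly = "(nat \<Rightarrow>\<^sub>0 nat) \<Rightarrow>\<^sub>0 quat"

definition slice_polys :: "nat set \<Rightarrow> slice_poly set" where
  "slice_polys V = {p. \<forall>l\<in>Poly_Mapping.keys p. Poly_Mapping.keys l \<subseteq> V}"

definition sp_var :: "nat \<Rightarrow> slice_poly" where
  "sp_var i = Poly_Mapping.single (Poly_Mapping.single i 1) 1"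

definition sp_const :: "quat \<Rightarrow> slice_poly" where
  "sp_const c = Poly_Mapping.single 0 c"

text \<open>\<open>\<bbbH>\<^sup>n\<close>, with coordinates indexed by \<open>1, \<dots>, n\<close>.\<close>

definition quat_space :: "nat \<Rightarrow> (nat \<Rightarrow> quat) set" where
  "quat_space n = {1..n} \<rightarrow>\<^sub>E UNIV"

text \<open>The monomial \<open>q\<^sub>1\<^bsup>l\<^sub>1\<^esup> \<cdots> q\<^sub>n\<^bsup>l\<^sub>n\<^esup>\<close>; the order of the factors matters.\<close>

definition slice_monom :: "nat \<Rightarrow> (nat \<Rightarrow>\<^sub>0 nat) \<Rightarrow> (nat \<Rightarrow> quat) \<Rightarrow> quat" where
  "slice_monom n l q = prod_list (map (\<lambda>i. q i ^ Poly_Mapping.lookup l i) [1..<Suc n])"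

definition slice_eval :: "nat \<Rightarrow> slice_poly \<Rightarrow> (nat \<Rightarrow> quat) \<Rightarrow> quat" where
  "slice_eval n p q = (\<Sum>l\<in>Poly_Mapping.keys p. slice_monom n l q * Poly_Mapping.lookup p l)"

lemma real_multipoly_eq_0:
  fixes c :: "(nat \<Rightarrow> nat) \<Rightarrow> real"
  assumes "finite A" "\<And>l l'. l \<in> A \<Longrightarrow> l' \<in> A \<Longrightarrow> (\<forall>i\<in>{1..n}. l i = l' i) \<Longrightarrow> l = l'"
    and "\<And>x. (\<Sum>l\<in>A. (\<Prod>i=1..n. x i ^ l i) * c l) = 0" and "l \<in> A"
  shows "c l = 0"
  using assms
proof (induction n arbitrary: A l)
  case 0
  then have "A = {l}" by auto
  with "0.prems"(3) show ?case by simp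
next
  case (Suc n)
  define d where "d = l (Suc n)"
  define M where "M = Max ((\<lambda>l. l (Suc n)) ` A)"
  define B where "B j = {l \<in> A. l (Suc n) = j}" for j
  have finB: "finite (B j)" for j using Suc.prems(1) by (simp add: B_def)
  have leM: "l' (Suc n) \<le> M" if "l' \<in> A" for l'
    using that Suc.prems(1) by (simp add: M_def)
  have "(\<Sum>l\<in>B d. (\<Prod>i=1..n. x i ^ l i) * c l) = 0" for x :: "nat \<Rightarrow> real"
  proof -
    define b where "b j = (\<Sum>l\<in>B j. (\<Prod>i=1..n. x i ^ l i) * c l)" for j
    have "(\<Sum>j\<le>M. b j * t ^ j) = 0" for t :: real
    proof -
      let ?x = "x(Suc n := t)"
      have "(\<Sum>j\<le>M. b j * t ^ j) =
          (\<Sum>j\<le>M. \<Sum>l\<in>B j. (\<Prod>i=1..Suc n. ?x i ^ l i) * c l)"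
        unfolding b_def sum_distrib_right
      proof (intro sum.cong refl)
        fix j l assume "l \<in> B j"
        moreover have "(\<Prod>i=1..n. ?x i ^ l i) = (\<Prod>i=1..n. x i ^ l i)"
          by (intro prod.cong) auto
        ultimately show "(\<Prod>i=1..n. x i ^ l i) * c l * t ^ j
            = (\<Prod>i=1..Suc n. ?x i ^ l i) * c l"
          by (simp add: B_def del: fun_upd_apply) simp
      qed
      also have "\<dots> = (\<Sum>l\<in>A. (\<Prod>i=1..Suc n. ?x i ^ l i) * c l)"
        unfolding B_def using Suc.prems(1) leM by (intro sum.group) auto
      also have "\<dots> = 0" by (rule Suc.prems(3))
      finally show ?thesis .
    qed
    then have "\<forall>j\<le>M. b j = 0"
      by (metis polyfun_eq_0)
    then show ?thesis
      using leM[OF Suc.prems(4)] by (simp add: b_def d_def)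
  qed
  moreover have "l1 = l2"
    if "l1 \<in> B d" "l2 \<in> B d" "\<forall>i\<in>{1..n}. l1 i = l2 i" for l1 l2
  proof (rule Suc.prems(2))
    show "\<forall>i\<in>{1..Suc n}. l1 i = l2 i"
      using that by (auto simp: B_def atLeastAtMostSuc_conv)
  qed (use that in \<open>auto simp: B_def\<close>)
  moreover have "l \<in> B d"
    using Suc.prems(4) by (simp add: B_def d_def)
  ultimately show ?case
    using Suc.IH[of "B d" l] finB by blast
qed

lemma slice_eval_minus: "slice_eval n (p - r) q = slice_eval n p q - slice_eval n r q"
proof -
  let ?K = "Poly_Mapping.keys p \<union> Poly_Mapping.keys r"
  have eval: "slice_eval n s q = (\<Sum>l\<in>?K. slice_monom n l q * Poly_Mapping.lookup s l)"
    if "Poly_Mapping.keys s \<subseteq> ?K" for s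
    unfolding slice_eval_def using that
    by (intro sum.mono_neutral_left) (auto simp: in_keys_iff)
  have "Poly_Mapping.keys (p - r) \<subseteq> ?K"
    by (auto simp: in_keys_iff lookup_minus)
  then show ?thesis
    by (simp add: eval lookup_minus sum_subtractf right_diff_distrib)
qed

lemma slice_eval_inject:
  assumes p: "p \<in> slice_polys {1..n}" and r: "r \<in> slice_polys {1..n}"
    and eq: "\<And>q. q \<in> quat_space n \<Longrightarrow> slice_eval n p q = slice_eval n r q"
  shows "p = r"
proof -
  define d where "d = p - r"
  have d0: "slice_eval n d q = 0" if "q \<in> quat_space n" for q
    using eq[OF that] by (simp add: d_def slice_eval_minus)
  have keys_d: "Poly_Mapping.keys l \<subseteq> {1..n}" if "l \<in> Poly_Mapping.keys d" for l
  proof -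
    have "l \<in> Poly_Mapping.keys p \<union> Poly_Mapping.keys r"
      using that by (auto simp: d_def in_keys_iff lookup_minus)
    then show ?thesis using p r unfolding slice_polys_def by blast
  qed
  let ?L = "Poly_Mapping.lookup :: (nat \<Rightarrow>\<^sub>0 nat) \<Rightarrow> nat \<Rightarrow> nat"
  have inj: "inj_on ?L (Poly_Mapping.keys d)"
    by (simp add: inj_on_def)
  have real_eval: "(\<Sum>l\<in>Poly_Mapping.keys d.
      (\<Prod>i=1..n. x i ^ ?L l i) *\<^sub>R Poly_Mapping.lookup d l) = 0" for x :: "nat \<Rightarrow> real"
  proof -
    let ?q = "restrict (\<lambda>i. of_real (x i)) {1..n}"
    have "slice_monom m l ?q = of_real (\<Prod>i=1..m. x i ^ ?L l i)" if "m \<le> n" for m l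
      using that by (induction m) (simp_all add: slice_monom_def)
    then have "slice_eval n d ?q = (\<Sum>l\<in>Poly_Mapping.keys d.
        (\<Prod>i=1..n. x i ^ ?L l i) *\<^sub>R Poly_Mapping.lookup d l)"
      by (simp add: slice_eval_def scaleR_conv_of_real)
    then show ?thesis
      using d0[of ?q] by (simp add: quat_space_def)
  qed
  have component: "f (Poly_Mapping.lookup d l) = 0"
    if f: "linear f" and l: "l \<in> Poly_Mapping.keys d" for f :: "quat \<Rightarrow> real" and l
  proof -
    define c where "c g = f (Poly_Mapping.lookup d (the_inv_into (Poly_Mapping.keys d) ?L g))" for g
    have c: "c (?L l) = f (Poly_Mapping.lookup d l)" if "l \<in> Poly_Mapping.keys d" for l
      using that by (simp add: c_def the_inv_into_f_f[OF inj])
    have "c (?L l) = 0"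
    proof (rule real_multipoly_eq_0
        [where A = "?L ` Poly_Mapping.keys d" and n = n and c = c and l = "?L l"])
      fix x :: "nat \<Rightarrow> real"
      have "(\<Sum>g\<in>?L ` Poly_Mapping.keys d. (\<Prod>i=1..n. x i ^ g i) * c g)
          = (\<Sum>l\<in>Poly_Mapping.keys d. (\<Prod>i=1..n. x i ^ ?L l i) * f (Poly_Mapping.lookup d l))"
        by (simp add: sum.reindex[OF inj] c)
      also have "\<dots> = f (\<Sum>l\<in>Poly_Mapping.keys d.
          (\<Prod>i=1..n. x i ^ ?L l i) *\<^sub>R Poly_Mapping.lookup d l)"
        by (simp add: linear_sum[OF f] linear_cmul[OF f])
      also have "\<dots> = 0"
        unfolding real_eval by (rule linear_0[OF f])
      finally show "(\<Sum>g\<in>?L ` Poly_Mapping.keys d. (\<Prod>i=1..n. x i ^ g i) * c g) = 0" .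
    next
      fix g g'
      assume g: "g \<in> ?L ` Poly_Mapping.keys d" "g' \<in> ?L ` Poly_Mapping.keys d"
        and eq: "\<forall>i\<in>{1..n}. g i = g' i"
      have "h i = 0" if h: "h \<in> ?L ` Poly_Mapping.keys d" "i \<notin> {1..n}" for h i
      proof -
        obtain l where "l \<in> Poly_Mapping.keys d" "h = ?L l" using h(1) by blast
        then show ?thesis using keys_d[of l] h(2) by (metis in_keys_iff subsetD)
      qed
      with g eq show "g = g'"
        by (metis ext)
    qed (use l in auto)
    then show ?thesis using c[OF l] by simp
  qed
  have lin: "linear qRe" "linear qI" "linear qJ" "linear qK"
    by (auto intro!: linearI)
  have "Poly_Mapping.keys d = {}"
  proof (rule ccontr)
    assume "Poly_Mapping.keys d \<noteq> {}"
    then obtain l where l: "l \<in> Poly_Mapping.keys d" by blast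
    have "Poly_Mapping.lookup d l = 0"
      using lin[THEN component, OF l] by (simp add: quat_eq_iff)
    with l show False by (simp add: in_keys_iff)
  qed
  then show ?thesis by (simp add: d_def)
qed

definition pairwise_commute :: "(nat \<Rightarrow> quat) \<Rightarrow> nat set \<Rightarrow> bool" where
  "pairwise_commute a I \<longleftrightarrow> (\<forall>l\<in>I. \<forall>m\<in>I. a l * a m = a m * a l)"

definition spherical_set :: "nat \<Rightarrow> (nat \<Rightarrow> quat) \<Rightarrow> (nat \<Rightarrow> quat) set" where
  "spherical_set k a = {restrict (\<lambda>i. inverse g * a i * g) {1..k} | g. g \<noteq> 0}"

text \<open>The product \<open>\<bbbS>\<^bsub>(a\<^sub>1,\<dots>,a\<^sub>k)\<^esub> \<times> {a\<^sub>k\<^sub>+\<^sub>1} \<times> \<cdots> \<times> {a\<^sub>n}\<close> as a subset of \<open>\<bbbH>\<^sup>n\<close>; it is a balloon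
  if \<open>is_balloon\<close> holds.\<close>

definition balloon :: "nat \<Rightarrow> nat \<Rightarrow> (nat \<Rightarrow> quat) \<Rightarrow> (nat \<Rightarrow> quat) set" where
  "balloon n k a =
     {q \<in> quat_space n. restrict q {1..k} \<in> spherical_set k a \<and> (\<forall>i\<in>{k+1..n}. q i = a i)}"

definition is_balloon :: "nat \<Rightarrow> nat \<Rightarrow> (nat \<Rightarrow> quat) \<Rightarrow> bool" where
  "is_balloon n k a \<longleftrightarrow> pairwise_commute a {1..k} \<and> pairwise_commute a {k+1..n}"

text \<open>\<open>J\<close> is an imaginary unit with \<open>a\<^sub>i = x\<^sub>i + y\<^sub>i J\<close> for \<open>1 \<le> i \<le> k\<close>.\<close>

definition slice_coords ::
  "nat \<Rightarrow> (nat \<Rightarrow> quat) \<Rightarrow> quat \<Rightarrow> (nat \<Rightarrow> real) \<Rightarrow> (nat \<Rightarrow> real) \<Rightarrow> bool" where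
  "slice_coords k a J x y \<longleftrightarrow>
     J * J = -1 \<and> (\<forall>i\<in>{1..k}. a i = of_real (x i) + of_real (y i) * J)"

text \<open>\<open>y\<^sub>l y\<^sub>l\<^sub>+\<^sub>1 > 0\<close> for some \<open>J\<close>. For commuting non-real \<open>a\<^sub>1, \<dots>, a\<^sub>k\<close> and \<open>1 \<le> l < k\<close>, such \<open>J\<close>
  exist, all \<open>y\<^sub>i\<close> are nonzero and the sign does not depend on \<open>J\<close>, so that the negation means
  \<open>y\<^sub>l y\<^sub>l\<^sub>+\<^sub>1 < 0\<close> (lemmas \<open>slice_coords_exist\<close> and \<open>same_side_iff\<close>).\<close>

definition same_side :: "nat \<Rightarrow> (nat \<Rightarrow> quat) \<Rightarrow> nat \<Rightarrow> bool" where
  "same_side k a l \<longleftrightarrow> (\<exists>J x y. slice_coords k a J x y \<and> y l * y (l + 1) > 0)"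

definition gamma :: "nat \<Rightarrow> (nat \<Rightarrow> quat) \<Rightarrow> nat \<Rightarrow> real" where
  "gamma k a l =
     (if same_side k a l then - (norm (qIm (a l)) / norm (qIm (a (l + 1))))
      else norm (qIm (a l)) / norm (qIm (a (l + 1))))"

definition delta :: "nat \<Rightarrow> (nat \<Rightarrow> quat) \<Rightarrow> nat \<Rightarrow> real" where
  "delta k a l =
     (if same_side k a l
      then - qRe (a l) + qRe (a (l + 1)) * norm (qIm (a l)) / norm (qIm (a (l + 1)))
      else - qRe (a l) - qRe (a (l + 1)) * norm (qIm (a l)) / norm (qIm (a (l + 1))))"

definition Q_poly :: "nat \<Rightarrow> (nat \<Rightarrow> quat) \<Rightarrow> nat \<Rightarrow> slice_poly" where
  "Q_poly k a l = sp_var l + sp_var (l + 1) * sp_const (of_real (gamma k a l))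
                  + sp_const (of_real (delta k a l))"

definition S_poly :: "quat \<Rightarrow> nat \<Rightarrow> slice_poly" where
  "S_poly c i = sp_var i ^ 2 - sp_const (of_real (2 * qRe c)) * sp_var i
                + sp_const (of_real ((norm c)\<^sup>2))"

lemma qRe_of_real [simp]: "qRe (of_real r) = r"
  and qI_of_real [simp]: "qI (of_real r) = 0"
  and qJ_of_real [simp]: "qJ (of_real r) = 0"
  and qK_of_real [simp]: "qK (of_real r) = 0"
  by (simp_all add: of_real_def)

lemma imag_unit_real_part:
  assumes "J * J = (-1 :: quat)"
  shows "qRe J = 0" "norm J = 1"
proof -
  have e: "qRe J * qRe J - qI J * qI J - qJ J * qJ J - qK J * qK J = -1"
    "qRe J * qI J = 0" "qRe J * qJ J = 0" "qRe J * qK J = 0"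
    using assms by (auto simp: quat_eq_iff algebra_simps)
  show "qRe J = 0"
  proof (rule ccontr)
    assume "qRe J \<noteq> 0"
    with e have "qRe J * qRe J = -1" by simp
    then show False by (metis zero_le_square neg_0_le_iff_le not_one_le_zero)
  qed
  have "norm J * norm J = 1"
    using arg_cong[OF assms, of norm] by (simp add: norm_mult)
  then show "norm J = 1"
    by (metis norm_ge_zero power2_eq_1_iff power2_eq_square neg_0_le_iff_le not_one_le_zero)
qed

lemma slice_coords_exist:
  assumes comm: "pairwise_commute a {1..k}" and nonreal: "\<forall>i\<in>{1..k}. a i \<notin> \<real>"
  shows "\<exists>J x y. slice_coords k a J x y"
proof (cases "k = 0")
  case True
  have "Quat 0 1 0 0 * Quat 0 1 0 0 = -1"
    by (simp add: quat_eq_iff)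
  with True show ?thesis by (auto simp: slice_coords_def)
next
  case False
  define v where "v = qIm (a 1)"
  have rv: "qRe v = 0" by (simp add: v_def qIm_def)
  have "v \<noteq> 0"
  proof
    assume "v = 0"
    then have "a 1 = of_real (qRe (a 1))" by (simp add: v_def qIm_def)
    then have "a 1 \<in> \<real>" by (metis Reals_of_real)
    with nonreal False show False by simp
  qed
  then have nv: "norm v \<noteq> 0" "(norm v)\<^sup>2 \<noteq> 0" by simp_all
  have nv2: "(norm v)\<^sup>2 = qI v * qI v + qJ v * qJ v + qK v * qK v"
    by (simp add: norm_quat_def rv power2_eq_square)
  define J where "J = v /\<^sub>R norm v"
  define y where "y i = inner (a i) v / norm v" for i
  have vv: "v * v = of_real (- (norm v)\<^sup>2)"
    by (simp add: quat_eq_iff nv2 rv algebra_simps)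
  have JJ: "J * J = -1"
    using nv by (simp add: J_def vv) (simp add: quat_eq_iff power2_eq_square field_simps)
  have "a i = of_real (qRe (a i)) + of_real (y i) * J" if "i \<in> {1..k}" for i
  proof -
    have "a i * a 1 = a 1 * a i"
      using comm that False by (simp add: pairwise_commute_def)
    then have "a i * v = v * a i"
      by (simp add: v_def qIm_def algebra_simps scaleR_conv_of_real[symmetric] of_real_def)
    then have cr: "qI (a i) * qJ v = qJ (a i) * qI v" "qJ (a i) * qK v = qK (a i) * qJ v"
      "qI (a i) * qK v = qK (a i) * qI v"
      by (auto simp: quat_eq_iff rv algebra_simps)
    have inn: "inner (a i) v = qI (a i) * qI v + qJ (a i) * qJ v + qK (a i) * qK v"
      by (simp add: inner_quat_def rv)
    have "of_real (y i) * J = (inner (a i) v / (norm v)\<^sup>2) *\<^sub>R v"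
    proof -
      have "of_real (y i) * J = y i *\<^sub>R J"
        by (simp only: scaleR_conv_of_real)
      then show ?thesis
        by (simp only: y_def J_def scaleR_scaleR power2_eq_square divide_inverse
            inverse_mult_distrib mult.assoc)
    qed
    moreover have "inner (a i) v * qI v = qI (a i) * (norm v)\<^sup>2"
      unfolding inn nv2 using cr by algebra
    moreover have "inner (a i) v * qJ v = qJ (a i) * (norm v)\<^sup>2"
      unfolding inn nv2 using cr by algebra
    moreover have "inner (a i) v * qK v = qK (a i) * (norm v)\<^sup>2"
      unfolding inn nv2 using cr by algebra
    ultimately show ?thesis
      using nv(2) by (simp add: quat_eq_iff rv nonzero_eq_divide_eq del: zero_eq_power2 power_eq_0_iff)
  qed
  with JJ have "slice_coords k a J (\<lambda>i. qRe (a i)) y"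
    by (simp add: slice_coords_def)
  then show ?thesis by blast
qed

lemma slice_coords_nonzero:
  assumes "slice_coords k a J x y" "i \<in> {1..k}" "a i \<notin> \<real>"
  shows "y i \<noteq> 0"
  using assms by (auto simp: slice_coords_def)

lemma same_side_iff:
  assumes sc: "slice_coords k a J x y" and l: "1 \<le> l" "l + 1 \<le> k"
  shows "same_side k a l \<longleftrightarrow> y l * y (l + 1) > 0"
proof -
  have "y l * y (l + 1) = inner (qIm (a l)) (qIm (a (l + 1)))"
    if "slice_coords k a J x y" for J x y
  proof -
    have J: "J * J = -1" using that by (simp add: slice_coords_def)
    have im: "qIm (a i) = y i *\<^sub>R J" if "i \<in> {1..k}" for i
      using \<open>slice_coords k a J x y\<close> that imag_unit_real_part(1)[OF J]
      by (simp add: slice_coords_def qIm_def scaleR_conv_of_real[symmetric])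
    have "inner J J = 1"
      using imag_unit_real_part(2)[OF J] by (simp add: norm_eq_1)
    with l show ?thesis by (simp add: im)
  qed
  with sc show ?thesis unfolding same_side_def by metis
qed

end

(* Modulo the right ideal generated by q_l - D, with D free of q_l, the variable q_l can be replaced
   by D. Dividing by q_n - a_n, ..., q_(k+1) - a_(k+1), then by Q_1, ..., Q_(k-1) and finally by the
   quadratic S leaves a remainder A + q_k B, which must vanish for all q_k = g^-1 a_k g. As a_k is
   not real, there are two distinct such q_k, hence B = 0 and A = 0. *)
theory Submission
  imports Defs
begin

section \<open>Support in a set of variables, central elements, and induction principles for
  \<open>slice_poly\<close>\<close>

subsection \<open>Slice polynomials\<close>

lemma slice_polys_single [simp]:
  "Poly_Mapping.single m c \<in> slice_polys V \<longleftrightarrow> c = 0 \<or> Poly_Mapping.keys m \<subseteq> V"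
  by (simp add: slice_polys_def)

lemma slice_polys_0 [simp]: "0 \<in> slice_polys V"
  by (simp add: slice_polys_def)

lemma slice_polys_add: "p \<in> slice_polys V \<Longrightarrow> r \<in> slice_polys V \<Longrightarrow> p + r \<in> slice_polys V"
  using keys_add[of p r] unfolding slice_polys_def by blast

lemma slice_polys_mult:
  assumes "p \<in> slice_polys V" "r \<in> slice_polys V"
  shows "p * r \<in> slice_polys V"
  unfolding slice_polys_def
proof safe
  fix l i assume "l \<in> Poly_Mapping.keys (p * r)" and i: "i \<in> Poly_Mapping.keys l"
  then obtain s t where st: "l = s + t" "s \<in> Poly_Mapping.keys p" "t \<in> Poly_Mapping.keys r"
    using keys_mult[of p r] by blast
  with i have "i \<in> Poly_Mapping.keys s \<union> Poly_Mapping.keys t"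
    using keys_add[of s t] by blast
  with st assms show "i \<in> V" unfolding slice_polys_def by blast
qed

lemma slice_polys_mono: "p \<in> slice_polys V \<Longrightarrow> V \<subseteq> W \<Longrightarrow> p \<in> slice_polys W"
  unfolding slice_polys_def by blast

lemma slice_polys_const [simp]: "sp_const c \<in> slice_polys V"
  by (simp add: sp_const_def)

lemma slice_polys_var [simp]: "i \<in> V \<Longrightarrow> sp_var i \<in> slice_polys V"
  by (simp add: sp_var_def)

lemma slice_poly_sum_singles:
  fixes p :: slice_poly
  shows "p = (\<Sum>l\<in>Poly_Mapping.keys p. Poly_Mapping.single l (Poly_Mapping.lookup p l))"
proof (rule poly_mapping_eqI)
  fix k
  show "Poly_Mapping.lookup p k = Poly_Mapping.lookup
      (\<Sum>l\<in>Poly_Mapping.keys p. Poly_Mapping.single l (Poly_Mapping.lookup p l)) k"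
    by (simp add: lookup_sum lookup_single when_def sum.delta in_keys_iff)
qed

text \<open>The induction adds up the terms of \<open>p\<close> itself, so each monomial that occurs
  is a key of \<open>p\<close> and has its support in \<open>V\<close>.\<close>

lemma slice_polys_induct [consumes 1, case_names zero single add]:
  assumes p: "p \<in> slice_polys V"
    and zero: "Pr 0"
    and single: "\<And>m c. Poly_Mapping.keys m \<subseteq> V \<Longrightarrow> Pr (Poly_Mapping.single m c)"
    and add: "\<And>p r. Pr p \<Longrightarrow> Pr r \<Longrightarrow> Pr (p + r)"
  shows "Pr p"
proof -
  have "Pr (\<Sum>l\<in>A. Poly_Mapping.single l (Poly_Mapping.lookup p l))"
    if "finite A" "A \<subseteq> Poly_Mapping.keys p" for A
    using that
  proof (induction A rule: finite_induct)
    case (insert l A)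
    then have "Poly_Mapping.keys l \<subseteq> V" using p unfolding slice_polys_def by blast
    with insert show ?case by (simp add: add single)
  qed (simp add: zero)
  from this[OF finite_keys order_refl] show ?thesis
    by (simp only: slice_poly_sum_singles[symmetric])
qed

lemma slice_poly_induct [case_names zero single add]:
  fixes p :: slice_poly
  assumes "Pr 0" "\<And>m c. Pr (Poly_Mapping.single m c)" "\<And>p r. Pr p \<Longrightarrow> Pr r \<Longrightarrow> Pr (p + r)"
  shows "Pr p"
proof -
  have "p \<in> slice_polys UNIV" by (simp add: slice_polys_def)
  then show ?thesis using assms by (rule slice_polys_induct)
qed

lemma sp_var_mult_single:
  "sp_var i * Poly_Mapping.single m c = Poly_Mapping.single (Poly_Mapping.single i 1 + m) c"
  by (simp add: sp_var_def mult_single)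

lemma sp_const_mult_single: "sp_const b * Poly_Mapping.single m c = Poly_Mapping.single m (b * c)"
  by (simp add: sp_const_def mult_single)

text \<open>Multi-indices add commutatively and the coefficient of \<open>sp_var i\<close> is 1.
  Variables are thus central for the *-product, although their quaternionic values need not
  commute.\<close>

lemma sp_var_commute: "sp_var i * p = p * sp_var i"
  by (induction p rule: slice_poly_induct)
    (simp_all add: sp_var_def mult_single add.commute distrib_left distrib_right)

lemma sp_const_arith:
  "sp_const (b + c) = sp_const b + sp_const c"
  "sp_const (b - c) = sp_const b - sp_const c"
  "sp_const (- c) = - sp_const c"
  "sp_const (b * c) = sp_const b * sp_const c"
  by (simp_all add: sp_const_def single_add single_diff single_uminus mult_single)

lemma sp_const_of_real_commute: "sp_const (of_real r) * p = p * sp_const (of_real r)"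
  by (induction p rule: slice_poly_induct)
    (simp_all add: sp_const_def mult_single distrib_left distrib_right of_real_def)

lemma slice_polys_empty:
  assumes "p \<in> slice_polys {}"
  obtains c where "p = sp_const c"
proof -
  have "\<exists>c. p = sp_const c"
    using assms
  proof (induction rule: slice_polys_induct)
    case zero
    show ?case by (intro exI[of _ 0]) (simp add: sp_const_def)
  next
    case (single m c)
    then show ?case by (auto simp: sp_const_def)
  next
    case (add p r)
    then show ?case by (metis sp_const_arith(1))
  qed
  then show ?thesis using that by blast
qed

text \<open>A Horner-type induction in the single variable \<open>l\<close>: a monomial is built
  from one free of \<open>l\<close> by multiplying with the central element \<open>sp_var l\<close>,
  as often as its exponent says. Both division lemmas follow this pattern.\<close>

lemma slice_polys_var_induct [consumes 1, case_names base add var]: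
  assumes p: "p \<in> slice_polys V"
    and base: "\<And>p. p \<in> slice_polys (V - {l}) \<Longrightarrow> Pr p"
    and add: "\<And>p r. Pr p \<Longrightarrow> Pr r \<Longrightarrow> Pr (p + r)"
    and var: "\<And>p. p \<in> slice_polys V \<Longrightarrow> l \<in> V \<Longrightarrow> Pr p \<Longrightarrow> Pr (sp_var l * p)"
  shows "Pr p"
  using p
proof (induction rule: slice_polys_induct)
  case zero
  show ?case by (simp add: base)
next
  case (single m c)
  then show ?case
  proof (induction "Poly_Mapping.lookup m l" arbitrary: m)
    case 0
    then have "Poly_Mapping.keys m \<subseteq> V - {l}" by (auto simp: in_keys_iff)
    then show ?case by (simp add: base)
  next
    case (Suc j)
    \<comment> \<open>The truncated subtraction is exact here, since the exponent of
      \<open>l\<close> in \<open>m\<close> is \<open>Suc j\<close>.\<close>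
    define m' where "m' = m - Poly_Mapping.single l 1"
    have m: "m = Poly_Mapping.single l 1 + m'"
    proof (rule poly_mapping_eqI)
      fix i
      show "Poly_Mapping.lookup m i = Poly_Mapping.lookup (Poly_Mapping.single l 1 + m') i"
        using Suc.hyps(2) by (cases "i = l") (simp_all add: m'_def lookup_add lookup_minus lookup_single)
    qed
    have keys: "Poly_Mapping.keys m' \<subseteq> V"
      using Suc.prems by (auto simp: m'_def in_keys_iff lookup_minus)
    have j: "j = Poly_Mapping.lookup m' l"
      using Suc.hyps(2) by (simp add: m'_def lookup_minus lookup_single)
    have "l \<in> V" using Suc.hyps(2) Suc.prems by (force simp: in_keys_iff)
    with var[OF _ _ Suc.hyps(1)[OF j keys]] keys show ?case
      by (simp add: sp_var_mult_single m[symmetric] del: One_nat_def)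
  qed
qed (rule add)

section \<open>Division with remainder by the monic polynomials \<open>sp_var l - D\<close> and
  \<open>S_poly c l\<close>\<close>

subsection \<open>Division\<close>

text \<open>The inductive step rests on q_l p = (q_l - D) p + D p: the first term is a multiple of
  the divisor, and in the second D acts on a decomposition already known. As D is free of q_l, so is
  the new remainder D r.\<close>

lemma slice_poly_division:
  assumes "p \<in> slice_polys V" and D: "D \<in> slice_polys (V - {l})"
  shows "\<exists>R\<in>slice_polys V. \<exists>r\<in>slice_polys (V - {l}). p = (sp_var l - D) * R + r"
  using assms(1)
proof (induction rule: slice_polys_var_induct[where l = l])
  case (base p)
  show ?case using base by (intro bexI[of _ 0] bexI[of _ p]) auto
next
  case (add p r)
  then obtain R s R' s' where R: "R \<in> slice_polys V" "s \<in> slice_polys (V - {l})"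
      "R' \<in> slice_polys V" "s' \<in> slice_polys (V - {l})"
    and p: "p = (sp_var l - D) * R + s" "r = (sp_var l - D) * R' + s'" by blast
  have "p + r = (sp_var l - D) * (R + R') + (s + s')"
    unfolding p distrib_left by (simp only: ac_simps)
  then show ?case using R slice_polys_add by blast
next
  case (var p)
  then obtain R r where R: "R \<in> slice_polys V" "r \<in> slice_polys (V - {l})"
    and p: "p = (sp_var l - D) * R + r" by blast
  have DV: "D \<in> slice_polys V" using D by (rule slice_polys_mono) blast
  \<comment> \<open>D commutes with itself and with the central q_l. This moves D past the divisor,
    so that the divisor stays on the left of every quotient.\<close>
  have comm: "D * (sp_var l - D) = (sp_var l - D) * D"
    by (simp add: left_diff_distrib right_diff_distrib sp_var_commute)
  have "sp_var l * p = (sp_var l - D) * p + D * p"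
    by (simp add: left_diff_distrib)
  also have "D * p = (sp_var l - D) * (D * R) + D * r"
    by (simp add: p distrib_left mult.assoc[symmetric] comm)
  finally have "sp_var l * p = (sp_var l - D) * (p + D * R) + D * r"
    by (simp add: distrib_left)
  moreover have "p + D * R \<in> slice_polys V"
    using var(1) DV R(1) by (intro slice_polys_add slice_polys_mult)
  moreover have "D * r \<in> slice_polys (V - {l})"
    using D R(2) by (rule slice_polys_mult)
  ultimately show ?case by blast
qed

text \<open>With q_k as the only variable left, the coefficients of the linear remainder are
  constants. Multiplying that remainder by q_l creates a term q_l^2 B, which is reduced by q_l^2 = S
  + 2 Re(c) q_l - |c|^2.\<close>

lemma slice_poly_division_quadratic:
  assumes "p \<in> slice_polys {l}"
  shows "\<exists>R\<in>slice_polys {l}. \<exists>A B. p = S_poly c l * R + sp_const A + sp_var l * sp_const B"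
  using assms
proof (induction rule: slice_polys_var_induct[where l = l])
  case (base p)
  then obtain A where "p = sp_const A" by (auto elim: slice_polys_empty)
  then show ?case
    by (intro bexI[of _ 0] exI[of _ A] exI[of _ 0]) (auto simp: sp_const_def)
next
  case (add p r)
  then obtain R A B R' A' B' where R: "R \<in> slice_polys {l}" "R' \<in> slice_polys {l}"
    and p: "p = S_poly c l * R + sp_const A + sp_var l * sp_const B"
           "r = S_poly c l * R' + sp_const A' + sp_var l * sp_const B'" by blast
  have "p + r = S_poly c l * (R + R') + sp_const (A + A') + sp_var l * sp_const (B + B')"
    unfolding p sp_const_arith distrib_left by (simp only: ac_simps)
  then show ?case using R slice_polys_add by blast
next
  case (var p)
  then obtain R A B where R: "R \<in> slice_polys {l}"
    and p: "p = S_poly c l * R + sp_const A + sp_var l * sp_const B" by blast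
  define r s where "r = sp_const (of_real (2 * qRe c))" and "s = sp_const (of_real ((norm c)\<^sup>2))"
  have S: "S_poly c l = sp_var l * sp_var l - r * sp_var l + s"
    by (simp add: S_poly_def power2_eq_square r_def s_def)
  have "sp_var l * p = sp_var l * S_poly c l * R + sp_var l * sp_const A
      + sp_var l * sp_var l * sp_const B"
    by (simp add: p distrib_left mult.assoc)
  also have "sp_var l * S_poly c l = S_poly c l * sp_var l"
    by (rule sp_var_commute)
  also have "sp_var l * sp_var l = S_poly c l + sp_var l * r - s"
    unfolding S by (simp add: sp_var_commute[of l r])
  finally have "sp_var l * p = S_poly c l * (sp_var l * R + sp_const B)
      + sp_const (- (of_real ((norm c)\<^sup>2) * B))
      + sp_var l * sp_const (A + of_real (2 * qRe c) * B)"
    unfolding sp_const_arith r_def[symmetric] s_def[symmetric]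
    by (simp add: algebra_simps)
  moreover have "sp_var l * R + sp_const B \<in> slice_polys {l}"
    using R by (intro slice_polys_add slice_polys_mult) auto
  ultimately show ?case by blast
qed

section \<open>Evaluation of products whose left factor is a generator of the right ideal\<close>

subsection \<open>Evaluation\<close>

lemma slice_eval_0 [simp]: "slice_eval n 0 q = 0"
  by (simp add: slice_eval_def)

lemma slice_eval_add: "slice_eval n (p + r) q = slice_eval n p q + slice_eval n r q"
  unfolding slice_eval_def by (rule setsum_keys_plus_distrib) (simp_all add: distrib_left)

lemma slice_eval_sum: "slice_eval n (\<Sum>i\<in>A. f i) q = (\<Sum>i\<in>A. slice_eval n (f i) q)"
  by (induction A rule: infinite_finite_induct) (simp_all add: slice_eval_add)

lemma slice_eval_single: "slice_eval n (Poly_Mapping.single m c) q = slice_monom n m q * c"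
  by (simp add: slice_eval_def)

lemma slice_monom_0 [simp]: "slice_monom n 0 q = 1"
  by (induction n) (simp_all add: slice_monom_def)

lemma slice_eval_const [simp]: "slice_eval n (sp_const c) q = c"
  by (simp add: sp_const_def slice_eval_single)

text \<open>Evaluation is not multiplicative for the *-product in general. A real factor is harmless
  because it commutes with the value of every monomial.\<close>

lemma slice_eval_of_real_mult:
  "slice_eval n (sp_const (of_real r) * p) q = of_real r * slice_eval n p q"
  by (induction p rule: slice_poly_induct)
    (simp_all add: sp_const_mult_single slice_eval_single distrib_left slice_eval_add of_real_def)

lemma commute_prod_list:
  fixes x :: "'a :: monoid_mult"
  assumes "\<And>y. y \<in> set ys \<Longrightarrow> y * x = x * y"
  shows "prod_list ys * x = x * prod_list ys"
  using assms by (induction ys) (simp, simp add: mult.assoc, metis mult.assoc)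

lemma prod_list_powers_single_add_outside:
  fixes q :: "nat \<Rightarrow> quat"
  assumes "l \<notin> set is"
  shows "prod_list (map (\<lambda>i. q i ^ Poly_Mapping.lookup (Poly_Mapping.single l 1 + m) i) is)
    = prod_list (map (\<lambda>i. q i ^ Poly_Mapping.lookup m i) is)"
  using assms by (intro arg_cong[where f = prod_list] map_cong)
    (auto simp: lookup_add lookup_single when_def)

text \<open>Raising the exponent of \<open>l\<close> inserts one more factor \<open>q l\<close> at
  the place of \<open>l\<close> in the ordered product; commutation with the factors before it
  brings it to the front.\<close>

lemma prod_list_powers_single_add:
  fixes q :: "nat \<Rightarrow> quat"
  assumes "distinct is" "l \<in> set is" "\<And>i. i \<in> set is \<Longrightarrow> q i * q l = q l * q i"
  shows "prod_list (map (\<lambda>i. q i ^ Poly_Mapping.lookup (Poly_Mapping.single l 1 + m) i) is)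
    = q l * prod_list (map (\<lambda>i. q i ^ Poly_Mapping.lookup m i) is)"
  using assms
proof (induction "is")
  case (Cons j js)
  show ?case
  proof (cases "j = l")
    case True
    with Cons.prems(1) prod_list_powers_single_add_outside[of l js q m] show ?thesis
      by (simp add: lookup_add lookup_single mult.assoc)
  next
    case False
    have "q j ^ e * q l = q l * q j ^ e" for e
      using Cons.prems(3)[of j] by (simp add: power_commuting_commutes)
    with False Cons show ?thesis
      by (simp add: lookup_add lookup_single) (metis mult.assoc)
  qed
qed simp

lemma slice_monom_split:
  assumes "k \<le> n"
  shows "slice_monom n m q = prod_list (map (\<lambda>i. q i ^ Poly_Mapping.lookup m i) [1..<Suc k]) *
    prod_list (map (\<lambda>i. q i ^ Poly_Mapping.lookup m i) [Suc k..<Suc n])"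
proof -
  have "[1..<Suc n] = [1..<Suc k] @ [Suc k..<Suc n]"
    using assms upt_add_eq_append[of 1 "Suc k" "n - k"] by simp
  then show ?thesis
    unfolding slice_monom_def by (simp only: map_append prod_list.append)
qed

text \<open>For \<open>l\<close> in the first block the extra factor \<open>q l\<close> only has to
  pass coordinates of that block, with which it commutes, to reach the front of the whole
  monomial.\<close>

lemma slice_eval_var_mult:
  assumes comm: "pairwise_commute q {1..k}" and "k \<le> n" "l \<in> {1..k}"
  shows "slice_eval n (sp_var l * p) q = q l * slice_eval n p q"
proof (induction p rule: slice_poly_induct)
  case (single m c)
  have "slice_monom n (Poly_Mapping.single l 1 + m) q = q l * slice_monom n m q"
    unfolding slice_monom_split[OF \<open>k \<le> n\<close>]
    using assms
    by (subst (2) prod_list_powers_single_add_outside, simp del: upt_Suc)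
      (subst prod_list_powers_single_add,
        auto simp del: upt_Suc simp: pairwise_commute_def mult.assoc)
  then show ?case by (simp add: sp_var_mult_single slice_eval_single mult.assoc)
qed (simp_all add: distrib_left slice_eval_add)

text \<open>For \<open>l\<close> in the last block the extra factor \<open>q l\<close> can be moved
  to the right end of the monomial, next to the coefficient \<open>c\<close>. There it equals the
  contribution of \<open>sp_const (q l)\<close>, which multiplies \<open>c\<close> from the left,
  and the two terms cancel.\<close>

lemma slice_eval_linear_mult_eq_0:
  assumes comm: "pairwise_commute q {k+1..n}" and "k \<le> n" "l \<in> {k+1..n}"
  shows "slice_eval n ((sp_var l - sp_const (q l)) * p) q = 0"
proof (induction p rule: slice_poly_induct)
  case (single m c)
  let ?t = "prod_list (map (\<lambda>i. q i ^ Poly_Mapping.lookup m i) [Suc k..<Suc n])"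
  \<comment> \<open>The second block of the monomial commutes with \<open>q l\<close>, so a factor
    pulled to the front of this block may be transferred to its end.\<close>
  have "?t * q l = q l * ?t"
    using assms
    by (intro commute_prod_list)
      (auto simp del: upt_Suc simp: pairwise_commute_def intro!: power_commuting_commutes)
  then have "slice_monom n (Poly_Mapping.single l 1 + m) q = slice_monom n m q * q l"
    unfolding slice_monom_split[OF \<open>k \<le> n\<close>]
    using assms
    by (subst prod_list_powers_single_add_outside, simp del: upt_Suc)
      (subst prod_list_powers_single_add,
        auto simp del: upt_Suc simp: pairwise_commute_def mult.assoc)
  then show ?case
    by (simp add: left_diff_distrib slice_eval_minus sp_var_mult_single sp_const_mult_single
        slice_eval_single mult.assoc)
qed (simp_all add: distrib_left slice_eval_add)

lemma slice_eval_Q_poly_mult: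
  assumes comm: "pairwise_commute q {1..k}" and "k \<le> n" and l: "1 \<le> l" "l + 1 \<le> k"
  shows "slice_eval n (Q_poly k a l * p) q
    = (q l + of_real (gamma k a l) * q (l + 1) + of_real (delta k a l)) * slice_eval n p q"
proof -
  have "Q_poly k a l * p = sp_var l * p + sp_const (of_real (gamma k a l)) * (sp_var (l + 1) * p)
      + sp_const (of_real (delta k a l)) * p"
    unfolding Q_poly_def by (simp add: distrib_right sp_const_of_real_commute mult.assoc)
  moreover have "slice_eval n (sp_var i * p) q = q i * slice_eval n p q" if "i \<in> {l, l + 1}" for i
    using comm \<open>k \<le> n\<close> by (rule slice_eval_var_mult) (use that l in auto)
  ultimately show ?thesis
    by (simp only: slice_eval_add slice_eval_of_real_mult insert_iff simp_thms
        distrib_right mult.assoc)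
qed

lemma slice_eval_S_poly_mult:
  assumes comm: "pairwise_commute q {1..k}" and "k \<le> n" "l \<in> {1..k}"
  shows "slice_eval n (S_poly c l * p) q
    = (q l * q l - of_real (2 * qRe c) * q l + of_real ((norm c)\<^sup>2)) * slice_eval n p q"
proof -
  have "S_poly c l * p = sp_var l * (sp_var l * p) - sp_const (of_real (2 * qRe c)) * (sp_var l * p)
      + sp_const (of_real ((norm c)\<^sup>2)) * p"
    unfolding S_poly_def power2_eq_square
    by (simp only: distrib_right left_diff_distrib mult.assoc)
  then show ?thesis
    by (simp only: slice_eval_add slice_eval_minus slice_eval_of_real_mult
        slice_eval_var_mult[OF assms] distrib_right left_diff_distrib mult.assoc)
qed

section \<open>Relations among the coordinates of a balloon point, and vanishing of the ideal on the
  balloon\<close>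

subsection \<open>Balloons\<close>

lemma slice_coords_parts:
  assumes sc: "slice_coords k a J x y" and i: "i \<in> {1..k}"
  shows "qRe (a i) = x i" "norm (qIm (a i)) = \<bar>y i\<bar>"
proof -
  have J: "J * J = -1" and ai: "a i = of_real (x i) + y i *\<^sub>R J"
    using sc i by (auto simp: slice_coords_def scaleR_conv_of_real)
  show "qRe (a i) = x i"
    by (simp add: ai imag_unit_real_part(1)[OF J])
  then have "qIm (a i) = y i *\<^sub>R J" by (simp add: qIm_def ai)
  then show "norm (qIm (a i)) = \<bar>y i\<bar>" by (simp add: imag_unit_real_part(2)[OF J])
qed

text \<open>Writing a_i = x_i + y_i J, gamma cancels the J-components of a_l and a_(l+1), and delta
  then cancels the real parts.\<close>

lemma Q_relation:
  assumes comm: "pairwise_commute a {1..k}" and nonreal: "\<forall>i\<in>{1..k}. a i \<notin> \<real>"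
    and l: "1 \<le> l" "l + 1 \<le> k"
  shows "a l + of_real (gamma k a l) * a (l + 1) + of_real (delta k a l) = 0"
proof -
  obtain J x y where sc: "slice_coords k a J x y"
    using slice_coords_exist[OF comm nonreal] by blast
  have i: "l \<in> {1..k}" "l + 1 \<in> {1..k}" using l by auto
  have y: "y l \<noteq> 0" "y (l + 1) \<noteq> 0"
    using slice_coords_nonzero[OF sc] i nonreal by blast+
  have ss: "same_side k a l \<longleftrightarrow> y l * y (l + 1) > 0"
    using sc l by (rule same_side_iff)
  \<comment> \<open>The case distinction in \<open>gamma\<close> restores the sign lost by the
    norms, so both cases give the same signed ratio.\<close>
  have g: "gamma k a l = - (y l / y (l + 1))"
    using y unfolding gamma_def ss slice_coords_parts(2)[OF sc i(1)] slice_coords_parts(2)[OF sc i(2)]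
    by (auto simp: zero_less_mult_iff abs_if)
  have d: "delta k a l = - x l - gamma k a l * x (l + 1)"
    unfolding delta_def gamma_def slice_coords_parts[OF sc i(1)] slice_coords_parts[OF sc i(2)]
    by (simp add: algebra_simps)
  have ai: "a i = of_real (x i) + y i *\<^sub>R J" if "i \<in> {1..k}" for i
    using sc that by (auto simp: slice_coords_def scaleR_conv_of_real)
  have "gamma k a l * y (l + 1) = - y l" using y by (simp add: g)
  then show ?thesis
    unfolding ai[OF i(1)] ai[OF i(2)] d
    by (simp add: distrib_left scaleR_conv_of_real[symmetric])
      (simp add: of_real_def algebra_simps)
qed

text \<open>A quaternion is a root of its own characteristic polynomial.\<close>

lemma S_relation: "c * c - of_real (2 * qRe c) * c + of_real ((norm c)\<^sup>2) = (0 :: quat)"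
  by (simp add: quat_eq_iff norm_quat_def power2_eq_square algebra_simps
      del: of_real_mult of_real_power)

text \<open>Conjugation by \<open>g\<close> is a ring automorphism fixing the reals. Hence
  polynomial relations with real coefficients pass from the a_i to all points of the spherical
  set.\<close>

lemma conjugate_polynomial:
  fixes g x y :: quat
  assumes "g \<noteq> 0"
  shows "inverse g * x * g * (inverse g * y * g) = inverse g * (x * y) * g"
    and "inverse g * x * g + of_real r * (inverse g * y * g) + of_real s
      = inverse g * (x + of_real r * y + of_real s) * g"
proof -
  have gg: "g * (inverse g * z) = z" for z
    using assms by (simp add: mult.assoc[symmetric])
  show "inverse g * x * g * (inverse g * y * g) = inverse g * (x * y) * g"
    by (simp add: mult.assoc gg)
  have r: "inverse g * (of_real t * z) = of_real t * (inverse g * z)" for t z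
    by (simp add: scaleR_conv_of_real[symmetric])
  have s: "inverse g * (of_real s * g) = of_real s"
    using assms by (simp add: r)
  show "inverse g * x * g + of_real r * (inverse g * y * g) + of_real s
      = inverse g * (x + of_real r * y + of_real s) * g"
    by (simp add: distrib_left distrib_right mult.assoc r s assms)
qed

lemma balloonE:
  assumes "q \<in> balloon n k a"
  obtains g where "g \<noteq> 0" "\<And>i. i \<in> {1..k} \<Longrightarrow> q i = inverse g * a i * g"
    "\<And>i. i \<in> {k+1..n} \<Longrightarrow> q i = a i"
proof -
  from assms obtain g where g: "g \<noteq> 0"
    and eq: "restrict q {1..k} = restrict (\<lambda>i. inverse g * a i * g) {1..k}"
    and q: "\<forall>i\<in>{k+1..n}. q i = a i"
    unfolding balloon_def spherical_set_def by blast
  have "q i = inverse g * a i * g" if "i \<in> {1..k}" for i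
    using fun_cong[OF eq, of i] that by simp
  with g q that show thesis by blast
qed

lemma balloonI:
  assumes "g \<noteq> 0" "k \<le> n"
  shows "restrict (\<lambda>i. if i \<le> k then inverse g * a i * g else a i) {1..n} \<in> balloon n k a"
  using assms unfolding balloon_def quat_space_def spherical_set_def by fastforce

lemma balloon_commute:
  assumes bal: "is_balloon n k a" and q: "q \<in> balloon n k a"
  shows "pairwise_commute q {1..k}" "pairwise_commute q {k+1..n}"
proof -
  obtain g where g: "g \<noteq> 0" "\<And>i. i \<in> {1..k} \<Longrightarrow> q i = inverse g * a i * g"
    "\<And>i. i \<in> {k+1..n} \<Longrightarrow> q i = a i"
    by (rule balloonE[OF q]) (rule that; simp)
  show "pairwise_commute q {1..k}"
    using bal by (simp add: is_balloon_def pairwise_commute_def g(2) conjugate_polynomial(1)[OF g(1)])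
  show "pairwise_commute q {k+1..n}"
    using bal g(3) by (simp add: is_balloon_def pairwise_commute_def)
qed

text \<open>Each summand vanishes by itself: the factors Q_l and S take the value 0 at conjugates of
  the a_i, and the linear factors cancel after evaluation. Besides giving one direction of the
  equivalence, this lets the converse discard everything but the remainder.\<close>

lemma slice_eval_balloon_eq_0:
  assumes "1 \<le> k" "k \<le> n" and bal: "is_balloon n k a" and nonreal: "\<forall>l\<in>{1..k}. a l \<notin> \<real>"
    and q: "q \<in> balloon n k a"
  shows "slice_eval n ((\<Sum>l=1..k-1. Q_poly k a l * R l) + S_poly (a k) k * R k
           + (\<Sum>l=k+1..n. (sp_var l - sp_const (a l)) * R l)) q = 0"
proof -
  obtain g where g: "g \<noteq> 0" "\<And>i. i \<in> {1..k} \<Longrightarrow> q i = inverse g * a i * g"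
    "\<And>i. i \<in> {k+1..n} \<Longrightarrow> q i = a i"
    by (rule balloonE[OF q]) (rule that; simp)
  note comm = balloon_commute[OF bal q]
  have comm_a: "pairwise_commute a {1..k}" using bal by (simp add: is_balloon_def)
  have "slice_eval n (Q_poly k a l * R l) q = 0" if "l \<in> {1..k-1}" for l
  proof -
    have l: "1 \<le> l" "l + 1 \<le> k" using that assms(1) by auto
    then have i: "l \<in> {1..k}" "l + 1 \<in> {1..k}" by auto
    show ?thesis
      unfolding slice_eval_Q_poly_mult[OF comm(1) \<open>k \<le> n\<close> l] g(2)[OF i(1)] g(2)[OF i(2)]
        conjugate_polynomial(2)[OF g(1)] Q_relation[OF comm_a nonreal l]
      by simp
  qed
  moreover have "slice_eval n (S_poly (a k) k * R k) q = 0"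
  proof -
    have k: "k \<in> {1..k}" using assms(1) by simp
    \<comment> \<open>This is \<open>S_relation\<close> for \<open>a k\<close>, transported by
      conjugation.\<close>
    have "inverse g * a k * g * (inverse g * a k * g) - of_real (2 * qRe (a k)) * (inverse g * a k * g)
        + of_real ((norm (a k))\<^sup>2) = 0"
      using conjugate_polynomial(2)[OF g(1), of "a k * a k" "- (2 * qRe (a k))" "a k" "(norm (a k))\<^sup>2"]
        S_relation[of "a k"] by (simp add: conjugate_polynomial(1)[OF g(1)])
    then show ?thesis
      unfolding slice_eval_S_poly_mult[OF comm(1) \<open>k \<le> n\<close> k] g(2)[OF k] by simp
  qed
  moreover have "slice_eval n ((sp_var l - sp_const (a l)) * R l) q = 0" if "l \<in> {k+1..n}" for l
    using slice_eval_linear_mult_eq_0[OF comm(2) \<open>k \<le> n\<close> that] g(3)[OF that] by simp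
  ultimately show ?thesis
    by (simp add: slice_eval_add slice_eval_sum)
qed

text \<open>Invariance under conjugation means commuting with every nonzero quaternion; commuting
  with the units i and j already kills all imaginary components. The contrapositive supplies a
  conjugate of \<open>a k\<close> different from \<open>a k\<close>.\<close>

lemma real_if_conjugation_invariant:
  fixes c :: quat
  assumes "\<And>g. g \<noteq> 0 \<Longrightarrow> inverse g * c * g = c"
  shows "c \<in> \<real>"
proof -
  have comm: "c * g = g * c" if "g \<noteq> 0" for g
  proof -
    have "g * (inverse g * c * g) = g * c" using assms[OF that] by simp
    with that show ?thesis by (simp add: mult.assoc[symmetric])
  qed
  have "Quat 0 1 0 0 \<noteq> 0" "Quat 0 0 1 0 \<noteq> 0" by (simp_all add: quat_eq_iff)
  with comm[of "Quat 0 1 0 0"] comm[of "Quat 0 0 1 0"] have "c = of_real (qRe c)"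
    by (simp add: quat_eq_iff)
  then show ?thesis by (metis Reals_of_real)
qed

section \<open>Successive division, and vanishing of the final remainder\<close>

subsection \<open>Elimination of variables\<close>

text \<open>The highest variable is divided out first. The remainder no longer contains it, so the
  induction hypothesis applies to that remainder.\<close>

lemma eliminate_fixed_variables:
  assumes "k \<le> m" "p \<in> slice_polys {1..m}"
  shows "\<exists>R. \<exists>r\<in>slice_polys {1..k}. (\<forall>l\<in>{k+1..m}. R l \<in> slice_polys {1..m}) \<and>
    p = (\<Sum>l=k+1..m. (sp_var l - sp_const (a l)) * R l) + r"
  using assms
proof (induction m arbitrary: p rule: dec_induct)
  case base
  then show ?case by auto
next
  case (step m)
  have V: "{1..Suc m} - {Suc m} = {1..m}" by auto
  obtain R r where R: "R \<in> slice_polys {1..Suc m}" "r \<in> slice_polys {1..m}"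
    and p: "p = (sp_var (Suc m) - sp_const (a (Suc m))) * R + r"
    using slice_poly_division[OF step.prems, of "sp_const (a (Suc m))" "Suc m"]
    unfolding V by auto
  obtain R' s where R': "\<forall>l\<in>{k+1..m}. R' l \<in> slice_polys {1..m}" "s \<in> slice_polys {1..k}"
    and r: "r = (\<Sum>l=k+1..m. (sp_var l - sp_const (a l)) * R' l) + s"
    using step.IH[OF R(2)] by blast
  let ?R = "R'(Suc m := R)"
  have "(\<Sum>l=k+1..m. (sp_var l - sp_const (a l)) * ?R l) =
      (\<Sum>l=k+1..m. (sp_var l - sp_const (a l)) * R' l)"
    by (intro sum.cong) auto
  then have "p = (\<Sum>l=k+1..Suc m. (sp_var l - sp_const (a l)) * ?R l) + s"
    using step.hyps by (simp add: p r add_ac del: fun_upd_apply) simp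
  moreover have "\<forall>l\<in>{k+1..Suc m}. ?R l \<in> slice_polys {1..Suc m}"
  proof
    fix l assume l: "l \<in> {k+1..Suc m}"
    show "?R l \<in> slice_polys {1..Suc m}"
    proof (cases "l = Suc m")
      case False
      then have "R' l \<in> slice_polys {1..m}" using l R'(1) by simp
      then have "R' l \<in> slice_polys {1..Suc m}" by (rule slice_polys_mono) simp
      with False show ?thesis by simp
    qed (simp add: R(1)[simplified])
  qed
  ultimately show ?case using R'(2) by blast
qed

text \<open>Here the lowest variable goes first. Before division by Q_j the remainder involves only
  q_j, ..., q_k, which is why the quotient belonging to Q_j needs no earlier variables.\<close>

lemma eliminate_spherical_variables:
  assumes "1 \<le> j" "j \<le> k" "p \<in> slice_polys {1..k}"
  shows "\<exists>R. \<exists>r\<in>slice_polys {j..k}. (\<forall>l\<in>{1..<j}. R l \<in> slice_polys {l..k}) \<and>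
    p = (\<Sum>l\<in>{1..<j}. Q_poly k a l * R l) + r"
  using assms
proof (induction j rule: dec_induct)
  case base
  then show ?case by auto
next
  case (step j)
  then obtain R r where R: "\<forall>l\<in>{1..<j}. R l \<in> slice_polys {l..k}" "r \<in> slice_polys {j..k}"
    and p: "p = (\<Sum>l\<in>{1..<j}. Q_poly k a l * R l) + r"
    by auto
  \<comment> \<open>Chosen so that Q_j = q_j - D; it contains only the next variable q_(j+1) and is
    therefore free of q_j.\<close>
  define D where "D = sp_const (of_real (- gamma k a j)) * sp_var (j + 1)
    + sp_const (of_real (- delta k a j))"
  have Q: "Q_poly k a j = sp_var j - D"
    unfolding Q_poly_def D_def
    by (simp add: sp_const_arith sp_const_of_real_commute[symmetric] minus_add_distrib algebra_simps)
  have V: "{j..k} - {j} = {Suc j..k}" by auto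
  have "D \<in> slice_polys {Suc j..k}"
    unfolding D_def using step.prems by (intro slice_polys_add slice_polys_mult) auto
  then obtain T s where T: "T \<in> slice_polys {j..k}" "s \<in> slice_polys {Suc j..k}"
    and r: "r = Q_poly k a j * T + s"
    using slice_poly_division[OF R(2), of D j] unfolding V Q by blast
  let ?R = "R(j := T)"
  have "(\<Sum>l\<in>{1..<j}. Q_poly k a l * ?R l) = (\<Sum>l\<in>{1..<j}. Q_poly k a l * R l)"
    by (intro sum.cong) auto
  then have "p = (\<Sum>l\<in>{1..<Suc j}. Q_poly k a l * ?R l) + s"
    using step.hyps by (simp add: p r add_ac del: fun_upd_apply) simp
  moreover have "\<forall>l\<in>{1..<Suc j}. ?R l \<in> slice_polys {l..k}"
    using R(1) T(1) by auto
  ultimately show ?case using T(2) by blast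
qed

theorem corollary3p15:
  fixes n k :: nat and a :: "nat \<Rightarrow> quat" and P :: slice_poly
  assumes "1 \<le> k" and "k \<le> n"
    and "is_balloon n k a"
    and "\<forall>l\<in>{1..k}. a l \<notin> \<real>"
    and "P \<in> slice_polys {1..n}"
  shows "(\<forall>q\<in>balloon n k a. slice_eval n P q = 0) \<longleftrightarrow>
    (\<exists>R :: nat \<Rightarrow> slice_poly.
       (\<forall>l\<in>{1..k}. R l \<in> slice_polys {l..n}) \<and>
       (\<forall>l\<in>{k+1..n}. R l \<in> slice_polys {1..n}) \<and>
       P = (\<Sum>l=1..k-1. Q_poly k a l * R l)
           + S_poly (a k) k * R k
           + (\<Sum>l=k+1..n. (sp_var l - sp_const (a l)) * R l))"
    (is "?vanishes \<longleftrightarrow> (\<exists>R. ?rep R)")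
proof
  assume "\<exists>R. ?rep R"
  then show ?vanishes using slice_eval_balloon_eq_0[OF assms(1-4)] by blast
next
  assume vanishes: ?vanishes
  obtain C r where C: "\<forall>l\<in>{k+1..n}. C l \<in> slice_polys {1..n}" and r: "r \<in> slice_polys {1..k}"
    and P: "P = (\<Sum>l=k+1..n. (sp_var l - sp_const (a l)) * C l) + r"
    using eliminate_fixed_variables[OF assms(2,5)] by blast
  obtain T s where T: "\<forall>l\<in>{1..<k}. T l \<in> slice_polys {l..k}" and s: "s \<in> slice_polys {k}"
    and r: "r = (\<Sum>l\<in>{1..<k}. Q_poly k a l * T l) + s"
    using eliminate_spherical_variables[OF assms(1) order_refl r]
    unfolding atLeastAtMost_singleton by blast
  obtain U A B where U: "U \<in> slice_polys {k}"
    and s: "s = S_poly (a k) k * U + sp_const A + sp_var k * sp_const B"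
    using slice_poly_division_quadratic[OF s] by blast
  \<comment> \<open>The quotients of the three divisions have disjoint index ranges and are glued
    into one family.\<close>
  define R where "R l = (if l < k then T l else if l = k then U else C l)" for l
  define M where "M = (\<Sum>l=1..k-1. Q_poly k a l * R l) + S_poly (a k) k * R k
           + (\<Sum>l=k+1..n. (sp_var l - sp_const (a l)) * R l)"
  have "(\<Sum>l=1..k-1. Q_poly k a l * R l) = (\<Sum>l\<in>{1..<k}. Q_poly k a l * T l)"
    using assms(1) by (intro sum.cong) (auto simp: R_def)
  moreover have "(\<Sum>l=k+1..n. (sp_var l - sp_const (a l)) * R l)
      = (\<Sum>l=k+1..n. (sp_var l - sp_const (a l)) * C l)"
    by (intro sum.cong) (auto simp: R_def)
  ultimately have PM: "P = M + (sp_const A + sp_var k * sp_const B)"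
    unfolding M_def P r s by (simp add: R_def add_ac)
  \<comment> \<open>On the balloon both \<open>P\<close> and \<open>M\<close> vanish, so the linear
    remainder vanishes too; the k-th coordinate runs through all conjugates of
    \<open>a k\<close>.\<close>
  have AB: "A + inverse g * a k * g * B = 0" if "g \<noteq> 0" for g
  proof -
    let ?q = "restrict (\<lambda>i. if i \<le> k then inverse g * a i * g else a i) {1..n}"
    have q: "?q \<in> balloon n k a" using that assms(2) by (rule balloonI)
    have "0 = slice_eval n P ?q" using vanishes q by simp
    also have "\<dots> = slice_eval n M ?q + slice_eval n (sp_const A + sp_var k * sp_const B) ?q"
      unfolding PM by (rule slice_eval_add)
    also have "slice_eval n M ?q = 0"
      unfolding M_def by (rule slice_eval_balloon_eq_0[OF assms(1-4) q])
    also have "0 + slice_eval n (sp_const A + sp_var k * sp_const B) ?q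
        = slice_eval n (sp_const A + sp_var k * sp_const B) ?q" by simp
    also have "\<dots> = A + ?q k * B"
      using assms(1) by (simp only: slice_eval_add slice_eval_const
          slice_eval_var_mult[OF balloon_commute(1)[OF assms(3) q] assms(2)] atLeastAtMost_iff order_refl)
    finally show ?thesis using assms(1,2) by simp
  qed
  obtain g where g: "g \<noteq> 0" "inverse g * a k * g \<noteq> a k"
    using real_if_conjugation_invariant[of "a k"] assms(1,4) by auto
  \<comment> \<open>Comparing the conjugators \<open>g\<close> and 1 gives (g^-1 a_k g - a_k) B = 0
    with a nonzero first factor, and quaternions have no zero divisors.\<close>
  have "A + inverse g * a k * g * B = A + a k * B"
    using AB[OF g(1)] AB[of 1] by simp
  then have B: "B = 0" using g(2) by simp
  then have A: "A = 0" using AB[of 1] by simp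
  have "P = M" unfolding PM A B by (simp add: sp_const_def)
  moreover have "R l \<in> slice_polys {l..n}" if "l \<in> {1..k}" for l
  proof (cases "l < k")
    case True
    then have "T l \<in> slice_polys {l..k}" using T that by simp
    with True assms(2) show ?thesis by (auto simp: R_def intro: slice_polys_mono)
  next
    case False
    with that U assms(2) show ?thesis by (auto simp: R_def intro: slice_polys_mono)
  qed
  moreover have "\<forall>l\<in>{k+1..n}. R l \<in> slice_polys {1..n}"
    using C by (simp add: R_def)
  ultimately show "\<exists>R. ?rep R" unfolding M_def by blast
qed

end
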